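(* Let $r,p$ be positive integers with $$p\ \ge\ 2\lceil\log_2 r\rceil+1,$$ where $\lceil x\rceil$ denotes the smallest integer at least as large as $x$. Then the parameters of the finite mixture of $r$ different Bernoulli products with $p$ components, i.e. of the $r$-class, $p$-binary-feature latent-class model $\mathcal{M}(r;2,2,\dots,2)$ (with $p$ twos), are generically identifiable, up to label swapping.
   Context: Model $\mathcal{M}(r;2,\dots,2)$: a latent variable $Z$ takes values in $\{1,\dots,r\}$ ($r$ known) with $\mathbb P(Z=i)=\pi_i$, where $\boldsymbol\pi=(\pi_1,\dots,\pi_r)$ has positive entries summing to $1$. The observed variables $X_1,\dots,X_p$, each with two states $\{1,2\}$, are independent conditional on $Z$, with $\mathbb P(X_j=l\mid Z=i)=\mathbf p_{ij}(l)$, where $\mathbf p_{ij}\in[0,1]^{2}$ and $\mathbf p_{ij}(1)+\mathbf p_{ij}(2)=1$. The distribution of $(X_1,\dots,X_p)$ is the $2\times\cdots\times2$ array with $(l_1,\dots,l_p)$-entry $\sum_{i=1}^r\pi_i\prod_{j=1}^p\mathbf p_{ij}(l_j)$. The parameter space $\Theta$ is the set of all $(\boldsymbol\pi,(\mathbf p_{ij}))$, identified (by dropping one coordinate from each probability vector) with a full-dimensional subset of $\mathbb R^{(r-1)+rp}$. Label swapping: two parameters $(\boldsymbol\pi,(\mathbf p_{ij}))$ and $(\boldsymbol\pi',(\mathbf p'_{ij}))$ are equal up to label swapping if there is a permutation $\sigma$ of $\{1,\dots,r\}$ with $\pi'_i=\pi_{\sigma(i)}$ and $\mathbf p'_{ij}=\mathbf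 p_{\sigma(i)j}$ for all $i,j$. Generic identifiability up to label swapping: there is a proper algebraic subvariety $V$ of $\mathbb R^{(r-1)+rp}$ (the common zero set of finitely many polynomials, not all identically zero) such that for every $\theta\in\Theta\setminus V$, every $\theta'\in\Theta$ giving the same distribution of $(X_1,\dots,X_p)$ equals $\theta$ up to label swapping. *)

theory Defs
  imports Complex_Main "HOL-Library.FuncSet" "HOL-Library.Poly_Mapping"
    "HOL-Combinatorics.Permutations"
begin

text \<open>A polynomial is a finitely supported map from monomials (finitely supported
  exponent maps) to coefficients.\<close>

type_synonym 'v real_mpoly = "('v \<Rightarrow>\<^sub>0 nat) \<Rightarrow>\<^sub>0 real"

definition indets :: "'v real_mpoly \<Rightarrow> 'v set" where
  "indets f = (\<Union>m\<in>Poly_Mapping.keys f. Poly_Mapping.keys m)"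

definition eval_mpoly :: "('v \<Rightarrow> real) \<Rightarrow> 'v real_mpoly \<Rightarrow> real" where
  "eval_mpoly x f =
     (\<Sum>m\<in>Poly_Mapping.keys f.
        Poly_Mapping.lookup f m * (\<Prod>v\<in>Poly_Mapping.keys m. x v ^ Poly_Mapping.lookup m v))"

text \<open>For a finite index set \<open>I\<close>, the space \<open>\<real>\<^sup>I\<close> is \<open>I \<rightarrow>\<^sub>E UNIV\<close>.  Since \<open>\<real>\<close> is infinite,
  a polynomial is identically zero on \<open>\<real>\<^sup>I\<close> iff it is the zero polynomial.\<close>

definition proper_subvariety :: "'v set \<Rightarrow> ('v \<Rightarrow> real) set \<Rightarrow> bool" where
  "proper_subvariety I V \<longleftrightarrow>
     (\<exists>F. finite F \<and> (\<forall>f\<in>F. indets f \<subseteq> I) \<and> (\<exists>f\<in>F. f \<noteq> 0) \<and>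
          V = {x \<in> I \<rightarrow>\<^sub>E UNIV. \<forall>f\<in>F. eval_mpoly x f = 0})"

text \<open>A parameter \<open>(w, P)\<close> consists of the class probabilities \<open>w i = \<P>(Z = i)\<close> and the
  conditional probabilities \<open>P i j l = \<P>(X\<^sub>j = l | Z = i)\<close>, for \<open>1 \<le> i \<le> r\<close>, \<open>1 \<le> j \<le> p\<close> and
  \<open>l \<in> {1, 2}\<close>.  Values outside these ranges are irrelevant to all notions below.\<close>

type_synonym mixture_param = "(nat \<Rightarrow> real) \<times> (nat \<Rightarrow> nat \<Rightarrow> nat \<Rightarrow> real)"

definition param_space :: "nat \<Rightarrow> nat \<Rightarrow> mixture_param set" where
  "param_space r p =
     {(w, P). (\<forall>i\<in>{1..r}. 0 < w i) \<and> (\<Sum>i\<in>{1..r}. w i) = 1 \<and>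
        (\<forall>i\<in>{1..r}. \<forall>j\<in>{1..p}. (\<forall>l\<in>{1, 2}. P i j l \<in> {0..1}) \<and> P i j 1 + P i j 2 = 1)}"

definition joint_dist :: "nat \<Rightarrow> nat \<Rightarrow> mixture_param \<Rightarrow> (nat \<Rightarrow> nat) \<Rightarrow> real" where
  "joint_dist r p = (\<lambda>(w, P).
     \<lambda>l\<in>{1..p} \<rightarrow>\<^sub>E {1, 2}. \<Sum>i\<in>{1..r}. w i * (\<Prod>j\<in>{1..p}. P i j (l j)))"

definition label_swap_eq :: "nat \<Rightarrow> nat \<Rightarrow> mixture_param \<Rightarrow> mixture_param \<Rightarrow> bool" where
  "label_swap_eq r p = (\<lambda>(w, P) (w', P').
     \<exists>\<sigma>. \<sigma> permutes {1..r} \<and>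
       (\<forall>i\<in>{1..r}. w' i = w (\<sigma> i) \<and>
          (\<forall>j\<in>{1..p}. \<forall>l\<in>{1, 2}. P' i j l = P (\<sigma> i) j l)))"

text \<open>The coordinates kept are \<open>w i\<close> for \<open>i < r\<close> and \<open>P i j 1\<close>; the remaining ones, \<open>w r\<close> and
  \<open>P i j 2\<close>, are determined because probabilities sum to one.\<close>

datatype coord = Weight nat | Prob nat nat

definition coords :: "nat \<Rightarrow> nat \<Rightarrow> coord set" where
  "coords r p = Weight ` {1..<r} \<union> (\<lambda>(i, j). Prob i j) ` ({1..r} \<times> {1..p})"

lemma card_coords: "card (coords r p) = (r - 1) + r * p"
proof -
  have "card (coords r p) =
      card (Weight ` {1..<r}) + card ((\<lambda>(i, j). Prob i j) ` ({1..r} \<times> {1..p}))"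
    unfolding coords_def by (intro card_Un_disjoint) auto
  then show ?thesis
    by (simp add: card_image inj_on_def)
qed

definition coord_vector :: "nat \<Rightarrow> nat \<Rightarrow> mixture_param \<Rightarrow> coord \<Rightarrow> real" where
  "coord_vector r p = (\<lambda>(w, P).
     \<lambda>c\<in>coords r p. case c of Weight i \<Rightarrow> w i | Prob i j \<Rightarrow> P i j 1)"

definition generically_identifiable :: "nat \<Rightarrow> nat \<Rightarrow> bool" where
  "generically_identifiable r p \<longleftrightarrow>
     (\<exists>V. proper_subvariety (coords r p) V \<and>
        (\<forall>\<theta>\<in>param_space r p. coord_vector r p \<theta> \<notin> V \<longrightarrow>
           (\<forall>\<theta>'\<in>param_space r p. joint_dist r p \<theta>' = joint_dist r p \<theta> \<longrightarrow>
              label_swap_eq r p \<theta> \<theta>')))"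

end

theory Submission
  imports Defs "Jordan_Normal_Form.Determinant"
begin

text \<open>
  Put \<open>k = \<lceil>log\<^sub>2 r\<rceil>\<close>, so \<open>r \<le> 2\<^sup>k\<close> and \<open>p \<ge> 2 k + 1\<close>.  The features are split into two blocks
  of \<open>k\<close> features each and a nonempty rest containing the feature \<open>c = 2 k + 1\<close>; the argument is a
  simultaneous diagonalization in the spirit of Kruskal's theorem on three-way arrays.

  Write \<open>a\<^sub>i(U)\<close> for the probability \<open>\<Prod>j\<in>U. P i j 1\<close> that in class \<open>i\<close> all features in \<open>U\<close> are in
  state 1.  Summing the joint distribution over the other features gives the moments
  \<open>\<Sum>i. w\<^sub>i a\<^sub>i(U)\<close>.  Suppose that for each block some \<open>r\<close> of its subsets \<open>S\<^sub>m\<close> make the matrix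
  \<open>a\<^sub>i(S\<^sub>m)\<close> invertible.  The inverse provides combinations of the moments that isolate a single class
  of \<open>\<theta>\<close>.  Applied to the moments of a second parameter \<open>\<theta>'\<close> with the same distribution, these
  combinations produce matrices \<open>F\<close> and \<open>G\<close> with
  \<open>F diag(w') G\<^sup>T = diag(w)\<close> and \<open>F diag(w' a'\<^sub>c) G\<^sup>T = diag(w a\<^sub>c)\<close>.
  As \<open>F\<close> is invertible by the first equation, the second turns into
  \<open>F diag(a'\<^sub>c) = diag(a\<^sub>c) F\<close>, so \<open>F\<close> is nonzero only where a class of \<open>\<theta>\<close> and a class of \<open>\<theta>'\<close> agree on
  feature \<open>c\<close>.  If the classes of \<open>\<theta>\<close> have pairwise different values there, \<open>F\<close> has exactly one nonzero
  entry in every row and column: this is the label permutation.  Isolating one class by the first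
  block then yields all features outside that block, and likewise for the second block
  (\<open>mixture_determined_by_moments\<close>).

  The hypotheses on \<open>\<theta>\<close> say that one polynomial in the coordinates, the product of the two block
  determinants and of the differences at feature \<open>c\<close>, does not vanish at \<open>\<theta>\<close>.  This polynomial is not
  zero: let the features of each block be the binary digits of the class number.  With \<open>S\<^sub>m\<close> the set
  of positions of the digit 1 in \<open>m\<close>, both block matrices are triangular with unit diagonal, which is
  where \<open>r \<le> 2\<^sup>k\<close> enters (\<open>nondegeneracy_nonzero_somewhere\<close>).
\<close>

section \<open>Square matrices given by their entries\<close>

lemma right_inverse_imp_left_inverse:
  fixes F X :: "nat \<Rightarrow> nat \<Rightarrow> real"
  assumes FX: "\<And>i h. i \<in> {1..r} \<Longrightarrow> h \<in> {1..r} \<Longrightarrow> (\<Sum>q\<in>{1..r}. F i q * X q h) = of_bool (i = h)"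
    and "q \<in> {1..r}" "s \<in> {1..r}"
  shows "(\<Sum>h\<in>{1..r}. X q h * F h s) = of_bool (q = s)"
proof -
  define A where "A = mat r r (\<lambda>(i, j). F (Suc i) (Suc j))"
  define B where "B = mat r r (\<lambda>(i, j). X (Suc i) (Suc j))"
  have AB: "A * B = 1\<^sub>m r"
  proof (rule eq_matI)
    fix i j assume "i < dim_row (1\<^sub>m r :: real mat)" "j < dim_col (1\<^sub>m r :: real mat)"
    then have ij: "i < r" "j < r" by auto
    then have "(A * B) $$ (i, j) = (\<Sum>k<r. F (Suc i) (Suc k) * X (Suc k) (Suc j))"
      by (simp add: A_def B_def scalar_prod_def atLeast0LessThan)
    also have "\<dots> = of_bool (i = j)"
      using FX[of "Suc i" "Suc j"] ij by (simp add: sum.atLeast1_atMost_eq)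
    finally show "(A * B) $$ (i, j) = 1\<^sub>m r $$ (i, j)" using ij by simp
  qed (auto simp: A_def B_def)
  have BA: "B * A = 1\<^sub>m r"
    by (rule mat_mult_left_right_inverse[OF _ _ AB]) (simp_all add: A_def B_def)
  obtain q' s' where qs: "q = Suc q'" "s = Suc s'" "q' < r" "s' < r"
    using assms(2,3) by (cases q; cases s) auto
  have "(\<Sum>h\<in>{1..r}. X q h * F h s) = (B * A) $$ (q', s')"
    using qs by (simp add: A_def B_def scalar_prod_def atLeast0LessThan sum.atLeast1_atMost_eq)
  then show ?thesis using qs by (simp add: BA)
qed

text \<open>Row \<open>h\<close> of \<open>M\<close> describes class \<open>h\<close>.  The columns of the inverse matrix give functionals \<open>f _ i\<close>
  that vanish on every class but \<open>i\<close>.\<close>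

lemma dual_family_if_det_nonzero:
  fixes M :: "nat \<Rightarrow> nat \<Rightarrow> real"
  assumes "det (mat r r (\<lambda>(i, m). M (Suc i) m)) \<noteq> 0"
  obtains f where
    "\<And>h i. h \<in> {1..r} \<Longrightarrow> i \<in> {1..r} \<Longrightarrow> (\<Sum>m<r. f m i * M h m) = of_bool (h = i)"
proof -
  define A where "A = mat r r (\<lambda>(i, m). M (Suc i) m)"
  have A: "A \<in> carrier_mat r r" by (simp add: A_def)
  have "A \<in> Units (ring_mat TYPE(real) r ())"
    using det_non_zero_imp_unit[OF A] assms by (simp add: A_def)
  then obtain B where B: "B \<in> carrier_mat r r" and AB: "A * B = 1\<^sub>m r"
    unfolding Units_def ring_mat_def by auto
  show ?thesis
  proof (rule that[of "\<lambda>m i. B $$ (m, i - 1)"])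
    fix h i assume "h \<in> {1..r}" "i \<in> {1..r}"
    then obtain h' i' where hi: "h = Suc h'" "i = Suc i'" "h' < r" "i' < r"
      by (cases h; cases i) auto
    have "(\<Sum>m<r. B $$ (m, i - 1) * M h m) = (A * B) $$ (h', i')"
      using hi B by (simp add: A_def scalar_prod_def atLeast0LessThan mult.commute)
    then show "(\<Sum>m<r. B $$ (m, i - 1) * M h m) = of_bool (h = i)"
      using hi by (simp add: AB)
  qed
qed

section \<open>Moments determine the mixture\<close>

text \<open>A functional on the block \<open>A\<close> is a combination of moments, because \<open>prod (a i)\<close> is multiplicative
  on disjoint sets.  It therefore replaces the weights by new ones and leaves the moments over the
  remaining features in agreement.  The conclusion has the form of the hypothesis \<open>mom\<close> with \<open>J - A\<close>
  for \<open>J\<close>, so that functionals on disjoint blocks can be applied one after the other.\<close>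

lemma moments_agree_after_test:
  fixes w w' :: "'i \<Rightarrow> real" and a a' :: "'i \<Rightarrow> 'j \<Rightarrow> real"
  assumes mom: "\<And>U. U \<subseteq> J \<Longrightarrow> (\<Sum>i\<in>I. w i * prod (a i) U) = (\<Sum>i\<in>I. w' i * prod (a' i) U)"
    and J: "finite J" "A \<subseteq> J" and S: "\<And>m. m \<in> M \<Longrightarrow> S m \<subseteq> A" and U: "U \<subseteq> J - A"
  shows "(\<Sum>i\<in>I. (w i * (\<Sum>m\<in>M. f m * prod (a i) (S m))) * prod (a i) U)
       = (\<Sum>i\<in>I. (w' i * (\<Sum>m\<in>M. f m * prod (a' i) (S m))) * prod (a' i) U)"
proof -
  have expand: "(\<Sum>i\<in>I. (v i * (\<Sum>m\<in>M. f m * prod (b i) (S m))) * prod (b i) U)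
      = (\<Sum>m\<in>M. f m * (\<Sum>i\<in>I. v i * prod (b i) (S m \<union> U)))" for v :: "'i \<Rightarrow> real" and b :: "'i \<Rightarrow> 'j \<Rightarrow> real"
  proof -
    have "prod (b i) (S m \<union> U) = prod (b i) (S m) * prod (b i) U" if "m \<in> M" for i m
    proof (rule prod.union_disjoint)
      show "finite (S m)" "finite U" "S m \<inter> U = {}"
        using S[OF that] U J finite_subset[of _ J] by blast+
    qed
    then have "(\<Sum>m\<in>M. f m * (\<Sum>i\<in>I. v i * prod (b i) (S m \<union> U)))
        = (\<Sum>m\<in>M. \<Sum>i\<in>I. f m * (v i * (prod (b i) (S m) * prod (b i) U)))"
      by (simp add: sum_distrib_left)
    also have "\<dots> = (\<Sum>i\<in>I. \<Sum>m\<in>M. f m * (v i * (prod (b i) (S m) * prod (b i) U)))"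
      by (rule sum.swap)
    finally show ?thesis
      by (simp only: sum_distrib_left sum_distrib_right mult_ac)
  qed
  have "(\<Sum>i\<in>I. w i * prod (a i) (S m \<union> U)) = (\<Sum>i\<in>I. w' i * prod (a' i) (S m \<union> U))" if "m \<in> M" for m
    using S[OF that] U J by (intro mom) blast
  then show ?thesis
    unfolding expand by simp
qed

text \<open>In matrix form the hypotheses are \<open>F diag(v) G\<^sup>T = diag(w)\<close> and
  \<open>F diag(v y) G\<^sup>T = diag(w x)\<close>.  The first makes \<open>X = diag(v) G\<^sup>T diag(w)\<^sup>-\<^sup>1\<close> a right inverse of the square
  matrix \<open>F\<close>, hence a two-sided one, and so \<open>F\<close> has no zero row or column.  The second then
  reads \<open>F diag(y) X = diag(x)\<close>; multiplication by \<open>F\<close> from the right gives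
  \<open>F diag(y) = diag(x) F\<close>, the entries of which are \<open>F i q * (y q - x i) = 0\<close>.\<close>

lemma common_factorization_support:
  fixes F G :: "nat \<Rightarrow> nat \<Rightarrow> real" and w v :: "nat \<Rightarrow> real"
  assumes w: "\<And>i. i \<in> {1..r} \<Longrightarrow> w i \<noteq> 0"
    and FG: "\<And>i h. i \<in> {1..r} \<Longrightarrow> h \<in> {1..r} \<Longrightarrow>
      (\<Sum>q\<in>{1..r}. v q * F i q * G h q) = w i * of_bool (i = h)"
    and FbG: "\<And>i h. i \<in> {1..r} \<Longrightarrow> h \<in> {1..r} \<Longrightarrow>
      (\<Sum>q\<in>{1..r}. v q * F i q * G h q * y q) = w i * x i * of_bool (i = h)"
  shows "\<And>i q. i \<in> {1..r} \<Longrightarrow> q \<in> {1..r} \<Longrightarrow> F i q \<noteq> 0 \<Longrightarrow> y q = x i"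
    and "\<And>q. q \<in> {1..r} \<Longrightarrow> \<exists>i\<in>{1..r}. F i q \<noteq> 0"
    and "\<And>i. i \<in> {1..r} \<Longrightarrow> \<exists>q\<in>{1..r}. F i q \<noteq> 0"
proof -
  define X where "X q h = v q * G h q / w h" for q h
  have FX: "(\<Sum>q\<in>{1..r}. F i q * X q h) = of_bool (i = h)" if "i \<in> {1..r}" "h \<in> {1..r}" for i h
  proof -
    have "(\<Sum>q\<in>{1..r}. F i q * X q h) = (\<Sum>q\<in>{1..r}. v q * F i q * G h q) / w h"
      by (simp add: X_def sum_divide_distrib mult_ac)
    then show ?thesis using FG[OF that] w[OF that(2)] by (auto split: if_splits)
  qed
  have XF: "(\<Sum>h\<in>{1..r}. X q h * F h s) = of_bool (q = s)" if "q \<in> {1..r}" "s \<in> {1..r}" for q s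
    using right_inverse_imp_left_inverse[of r F X, OF FX that] .
  have FyX: "(\<Sum>s\<in>{1..r}. F i s * (y s - x i) * X s h) = 0" if "i \<in> {1..r}" "h \<in> {1..r}" for i h
  proof -
    have "(\<Sum>s\<in>{1..r}. F i s * (y s - x i) * X s h)
        = ((\<Sum>s\<in>{1..r}. v s * F i s * G h s * y s) - x i * (\<Sum>s\<in>{1..r}. v s * F i s * G h s)) / w h"
      unfolding sum_distrib_left sum_subtractf[symmetric] sum_divide_distrib
      by (intro sum.cong refl) (simp add: X_def algebra_simps diff_divide_distrib)
    also have "\<dots> = 0" unfolding FG[OF that] FbG[OF that] by simp
    finally show ?thesis .
  qed
  show "y q = x i" if i: "i \<in> {1..r}" and q: "q \<in> {1..r}" and nz: "F i q \<noteq> 0" for i q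
  proof -
    \<comment> \<open>Expand the column \<open>q\<close> of the identity matrix as \<open>X F\<close>.\<close>
    have "F i q * (y q - x i) = (\<Sum>s\<in>{1..r}. F i s * (y s - x i) * of_bool (s = q))"
      using q by (simp add: of_bool_def if_distrib[of "\<lambda>t. _ * t"] cong: if_cong)
    also have "\<dots> = (\<Sum>s\<in>{1..r}. F i s * (y s - x i) * (\<Sum>h\<in>{1..r}. X s h * F h q))"
      by (intro sum.cong refl) (simp only: XF q)
    also have "\<dots> = (\<Sum>h\<in>{1..r}. (\<Sum>s\<in>{1..r}. F i s * (y s - x i) * X s h) * F h q)"
      unfolding sum_distrib_left sum_distrib_right
      by (subst sum.swap) (simp add: mult_ac)
    also have "\<dots> = 0" using FyX[OF i] by simp
    finally show ?thesis using nz by simp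
  qed
  show "\<exists>i\<in>{1..r}. F i q \<noteq> 0" if q: "q \<in> {1..r}" for q
  proof (rule ccontr)
    assume "\<not> ?thesis"
    then have "(\<Sum>h\<in>{1..r}. X q h * F h q) = 0" by simp
    then show False using XF[OF q q] by simp
  qed
  show "\<exists>q\<in>{1..r}. F i q \<noteq> 0" if i: "i \<in> {1..r}" for i
  proof (rule ccontr)
    assume "\<not> ?thesis"
    then have "(\<Sum>q\<in>{1..r}. F i q * X q i) = 0" by simp
    then show False using FX[OF i i] by simp
  qed
qed

text \<open>The families \<open>f\<close> and \<open>g\<close> isolate the classes of the unprimed mixture by functionals on the
  blocks \<open>A\<close> and \<open>B\<close>; \<open>F i q\<close> and \<open>G i q\<close> in the proof are the values of the functionals for class
  \<open>i\<close> at class \<open>q\<close> of the primed mixture.  Using both on the moments over \<open>{}\<close> and \<open>{c}\<close> leads to the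
  situation of \<open>common_factorization_support\<close>.\<close>

lemma mixture_determined_by_moments:
  fixes w w' :: "nat \<Rightarrow> real" and a a' :: "nat \<Rightarrow> 'j \<Rightarrow> real"
  assumes mom: "\<And>U. U \<subseteq> J \<Longrightarrow>
      (\<Sum>i\<in>{1..r}. w i * prod (a i) U) = (\<Sum>i\<in>{1..r}. w' i * prod (a' i) U)"
    and w: "\<And>i. i \<in> {1..r} \<Longrightarrow> w i \<noteq> 0"
    and J: "finite J" "A \<subseteq> J" "B \<subseteq> J" "c \<in> J" "A \<inter> B = {}" "c \<notin> A" "c \<notin> B"
    and S: "\<And>m. m < r \<Longrightarrow> S m \<subseteq> A" and T: "\<And>m. m < r \<Longrightarrow> T m \<subseteq> B"
    and f: "\<And>h i. h \<in> {1..r} \<Longrightarrow> i \<in> {1..r} \<Longrightarrow>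
      (\<Sum>m<r. f m i * prod (a h) (S m)) = of_bool (h = i)"
    and g: "\<And>h i. h \<in> {1..r} \<Longrightarrow> i \<in> {1..r} \<Longrightarrow>
      (\<Sum>m<r. g m i * prod (a h) (T m)) = of_bool (h = i)"
    and inj: "inj_on (\<lambda>i. a i c) {1..r}"
  shows "\<exists>\<sigma>. \<sigma> permutes {1..r} \<and>
    (\<forall>i\<in>{1..r}. w' i = w (\<sigma> i) \<and> (\<forall>j\<in>J. a' i j = a (\<sigma> i) j))"
proof -
  define F where "F i q = (\<Sum>m<r. f m i * prod (a' q) (S m))" for i q
  define G where "G i q = (\<Sum>m<r. g m i * prod (a' q) (T m))" for i q
  have sum_delta: "(\<Sum>l\<in>{1..r}. \<phi> l * of_bool (l = i)) = \<phi> i" if "i \<in> {1..r}" for \<phi> :: "nat \<Rightarrow> real" and i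
    using that by (simp add: of_bool_def if_distrib[of "\<lambda>t. _ * t"] cong: if_cong)
  have A_tested: "(\<Sum>q\<in>{1..r}. (w' q * F i q) * prod (a' q) U)
      = (\<Sum>l\<in>{1..r}. (w l * of_bool (l = i)) * prod (a l) U)"
    if i: "i \<in> {1..r}" and U: "U \<subseteq> J - A" for i U
  proof -
    have "(\<Sum>q\<in>{1..r}. (w' q * F i q) * prod (a' q) U)
        = (\<Sum>l\<in>{1..r}. (w l * (\<Sum>m<r. f m i * prod (a l) (S m))) * prod (a l) U)"
      unfolding F_def
      by (rule moments_agree_after_test[OF mom J(1,2) _ U, symmetric]) (simp_all add: S)
    then show ?thesis by (simp only: f[OF _ i] cong: sum.cong)
  qed
  have B_tested: "(\<Sum>q\<in>{1..r}. (w' q * G i q) * prod (a' q) U)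
      = (\<Sum>l\<in>{1..r}. (w l * of_bool (l = i)) * prod (a l) U)"
    if i: "i \<in> {1..r}" and U: "U \<subseteq> J - B" for i U
  proof -
    have "(\<Sum>q\<in>{1..r}. (w' q * G i q) * prod (a' q) U)
        = (\<Sum>l\<in>{1..r}. (w l * (\<Sum>m<r. g m i * prod (a l) (T m))) * prod (a l) U)"
      unfolding G_def
      by (rule moments_agree_after_test[OF mom J(1,3) _ U, symmetric]) (simp_all add: T)
    then show ?thesis by (simp only: g[OF _ i] cong: sum.cong)
  qed
  have AB_tested: "(\<Sum>q\<in>{1..r}. (w' q * F i q * G h q) * prod (a' q) U) = w i * prod (a i) U * of_bool (i = h)"
    if ih: "i \<in> {1..r}" "h \<in> {1..r}" and U: "U \<subseteq> J - A - B" for i h U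
  proof -
    have "(\<Sum>q\<in>{1..r}. (w' q * F i q * G h q) * prod (a' q) U)
        = (\<Sum>l\<in>{1..r}. (w l * of_bool (l = i) * (\<Sum>m<r. g m h * prod (a l) (T m))) * prod (a l) U)"
      unfolding G_def
      by (rule moments_agree_after_test[OF A_tested[OF ih(1)] _ _ _ U]) (use J T in auto)
    also have "\<dots> = (\<Sum>l\<in>{1..r}. (w l * of_bool (l = i) * of_bool (l = h)) * prod (a l) U)"
      by (simp only: g[OF _ ih(2)] cong: sum.cong)
    also have "\<dots> = (\<Sum>l\<in>{1..r}. (w l * of_bool (l = h) * prod (a l) U) * of_bool (l = i))"
      by (simp only: mult_ac)
    also have "\<dots> = w i * prod (a i) U * of_bool (i = h)"
      unfolding sum_delta[OF ih(1)] by (simp only: mult_ac)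
    finally show ?thesis .
  qed
  have Fs: "(\<Sum>q\<in>{1..r}. w' q * F i q * prod (a' q) U) = w i * prod (a i) U"
    if i: "i \<in> {1..r}" and U: "U \<subseteq> J - A" for i U
    using A_tested[OF that] sum_delta[OF i, of "\<lambda>l. w l * prod (a l) U"] by (simp only: mult_ac)
  have Gs: "(\<Sum>q\<in>{1..r}. w' q * G i q * prod (a' q) U) = w i * prod (a i) U"
    if i: "i \<in> {1..r}" and U: "U \<subseteq> J - B" for i U
    using B_tested[OF that] sum_delta[OF i, of "\<lambda>l. w l * prod (a l) U"] by (simp only: mult_ac)

  have FG1: "(\<Sum>q\<in>{1..r}. w' q * F i q * G h q) = w i * of_bool (i = h)"
    if "i \<in> {1..r}" "h \<in> {1..r}" for i h
    using AB_tested[OF that, of "{}"] by (simp only: prod.empty mult_1_right empty_subsetI)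
  have FGc: "(\<Sum>q\<in>{1..r}. w' q * F i q * G h q * a' q c) = w i * a i c * of_bool (i = h)"
    if "i \<in> {1..r}" "h \<in> {1..r}" for i h
  proof -
    have "{c} \<subseteq> J - A - B" using J by blast
    from AB_tested[OF that this] show ?thesis by (simp only: prod.insert prod.empty finite.emptyI empty_iff not_False_eq_True mult_1_right)
  qed
  note F_support = common_factorization_support[of r w w' F G "\<lambda>q. a' q c" "\<lambda>i. a i c"]
  have F1: "a' q c = a i c" if "i \<in> {1..r}" "q \<in> {1..r}" "F i q \<noteq> 0" for i q
    by (rule F_support(1); (rule w FG1 FGc that)?; assumption?)
  have F2: "\<exists>i\<in>{1..r}. F i q \<noteq> 0" if "q \<in> {1..r}" for q
    by (rule F_support(2); (rule w FG1 FGc that)?; assumption?)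
  have F3: "\<exists>q\<in>{1..r}. F i q \<noteq> 0" if "i \<in> {1..r}" for i
    by (rule F_support(3); (rule w FG1 FGc that)?; assumption?)
  have GF1: "(\<Sum>q\<in>{1..r}. w' q * G i q * F h q) = w i * of_bool (i = h)"
    if "i \<in> {1..r}" "h \<in> {1..r}" for i h
    using FG1[OF that(2,1)] by (cases "i = h") (simp_all add: mult_ac)
  have GFc: "(\<Sum>q\<in>{1..r}. w' q * G i q * F h q * a' q c) = w i * a i c * of_bool (i = h)"
    if "i \<in> {1..r}" "h \<in> {1..r}" for i h
    using FGc[OF that(2,1)] by (cases "i = h") (simp_all add: mult_ac)
  have G1: "a' q c = a i c" if "i \<in> {1..r}" "q \<in> {1..r}" "G i q \<noteq> 0" for i q
    by (rule common_factorization_support(1)[of r w w' G F "\<lambda>q. a' q c" "\<lambda>i. a i c"];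
        (rule w GF1 GFc that)?; assumption?)

  \<comment> \<open>By injectivity at \<open>c\<close>, column \<open>q\<close> of \<open>F\<close> has exactly one nonzero entry, in row \<open>\<sigma> q\<close>; outside
    the class labels \<open>\<sigma>\<close> must be the identity to be a permutation of them.\<close>
  define \<sigma> where "\<sigma> q = (if q \<in> {1..r} then SOME i. i \<in> {1..r} \<and> F i q \<noteq> 0 else q)" for q
  have \<sigma>: "\<sigma> q \<in> {1..r}" "F (\<sigma> q) q \<noteq> 0" if "q \<in> {1..r}" for q
    using someI_ex[of "\<lambda>i. i \<in> {1..r} \<and> F i q \<noteq> 0"] F2[OF that] that unfolding \<sigma>_def by (simp_all add: Bex_def del: One_nat_def)
  have a'c: "a' q c = a (\<sigma> q) c" if "q \<in> {1..r}" for q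
    using F1 \<sigma> that by blast
  have F\<sigma>: "i = \<sigma> q" if "i \<in> {1..r}" "q \<in> {1..r}" "F i q \<noteq> 0" for i q
    using inj_onD[OF inj _ that(1) \<sigma>(1)[OF that(2)]] F1[OF that] a'c[OF that(2)] by simp
  have G\<sigma>: "i = \<sigma> q" if "i \<in> {1..r}" "q \<in> {1..r}" "G i q \<noteq> 0" for i q
    using inj_onD[OF inj _ that(1) \<sigma>(1)[OF that(2)]] G1[OF that] a'c[OF that(2)] by simp
  have "\<sigma> ` {1..r} = {1..r}"
  proof
    show "{1..r} \<subseteq> \<sigma> ` {1..r}"
      using F3 F\<sigma> by blast
  qed (use \<sigma>(1) in blast)
  then have bij: "bij_betw \<sigma> {1..r} {1..r}"
    by (simp add: bij_betw_def eq_card_imp_inj_on)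
  have perm: "\<sigma> permutes {1..r}"
    using bij by (rule bij_imp_permutes) (simp only: \<sigma>_def if_False)
  \<comment> \<open>Rows have only one nonzero entry as well, so testing for class \<open>\<sigma> q\<close> isolates the primed class \<open>q\<close>.\<close>
  have single: "(\<Sum>s\<in>{1..r}. w' s * H (\<sigma> q) s * \<phi> s) = w' q * H (\<sigma> q) q * \<phi> q"
    if q: "q \<in> {1..r}" and H: "\<And>i q. i \<in> {1..r} \<Longrightarrow> q \<in> {1..r} \<Longrightarrow> H i q \<noteq> 0 \<Longrightarrow> i = \<sigma> q"
    for q and H :: "nat \<Rightarrow> nat \<Rightarrow> real" and \<phi>
  proof -
    have "w' s * H (\<sigma> q) s * \<phi> s = 0" if "s \<in> {1..r} - {q}" for s
    proof -
      have "\<sigma> q \<noteq> \<sigma> s"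
        using that q bij unfolding bij_betw_def inj_on_def by blast
      then have "H (\<sigma> q) s = 0" using H[of "\<sigma> q" s] \<sigma>(1)[OF q] that by blast
      then show ?thesis by simp
    qed
    then have "(\<Sum>s\<in>{1..r}. w' s * H (\<sigma> q) s * \<phi> s) = (\<Sum>s\<in>{q}. w' s * H (\<sigma> q) s * \<phi> s)"
      using q by (intro sum.mono_neutral_right) auto
    then show ?thesis by simp
  qed
  have "w' q = w (\<sigma> q) \<and> (\<forall>j\<in>J. a' q j = a (\<sigma> q) j)" if q: "q \<in> {1..r}" for q
  proof -
    have Fq: "w' q * F (\<sigma> q) q * prod (a' q) U = w (\<sigma> q) * prod (a (\<sigma> q)) U" if "U \<subseteq> J - A" for U
      using Fs[OF \<sigma>(1)[OF q] that] single[OF q, of F "\<lambda>s. prod (a' s) U", OF F\<sigma>] by simp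
    have Gq: "w' q * G (\<sigma> q) q * prod (a' q) U = w (\<sigma> q) * prod (a (\<sigma> q)) U" if "U \<subseteq> J - B" for U
      using Gs[OF \<sigma>(1)[OF q] that] single[OF q, of G "\<lambda>s. prod (a' s) U", OF G\<sigma>] by simp
    have wq: "w (\<sigma> q) \<noteq> 0" using w \<sigma>(1) q by blast
    have eq_if_scaled: "a' q j = a (\<sigma> q) j"
      if "\<And>U. U \<subseteq> K \<Longrightarrow> w' q * s * prod (a' q) U = w (\<sigma> q) * prod (a (\<sigma> q)) U" "j \<in> K" for j s K
    proof -
      have "w' q * s = w (\<sigma> q)" using that(1)[of "{}"] by simp
      then show ?thesis using that(1)[of "{j}"] that(2) wq by simp
    qed
    have eq: "a' q j = a (\<sigma> q) j" if "j \<in> J" for j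
    proof (cases "j \<in> A")
      case True
      then show ?thesis using eq_if_scaled[OF Gq] J that by blast
    next
      case False
      then show ?thesis using eq_if_scaled[OF Fq] that by blast
    qed
    \<comment> \<open>The two classes agree on the block \<open>A\<close>, so the functional for \<open>\<sigma> q\<close> takes the same value 1 at both.\<close>
    have "prod (a' q) (S m) = prod (a (\<sigma> q)) (S m)" if "m < r" for m
      using S[OF that] J eq by (intro prod.cong) auto
    then have "F (\<sigma> q) q = 1"
      using f[of "\<sigma> q" "\<sigma> q"] \<sigma>(1)[OF q] by (simp add: F_def)
    then show ?thesis using Fq[of "{}"] eq by simp
  qed
  then show ?thesis using perm by blast
qed

section \<open>From the joint distribution to moments\<close>

text \<open>The moment over \<open>U\<close> is the probability that all features in \<open>U\<close> are in state 1, that is, a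
  marginal of the joint distribution.  The weight \<open>e j\<close> in the proof admits only state 1 for \<open>j \<in> U\<close> and
  both states otherwise; in the second case the two probabilities sum to 1.\<close>

lemma moments_from_joint_dist:
  assumes \<theta>: "(w, P) \<in> param_space r p" and U: "U \<subseteq> {1..p}"
  shows "(\<Sum>i\<in>{1..r}. w i * (\<Prod>j\<in>U. P i j 1))
       = (\<Sum>l\<in>{1..p} \<rightarrow>\<^sub>E {1, 2}. of_bool (\<forall>j\<in>U. l j = 1) * joint_dist r p (w, P) l)"
proof -
  define e :: "nat \<Rightarrow> nat \<Rightarrow> real" where "e j x = of_bool (j \<in> U \<longrightarrow> x = 1)" for j x
  have e: "(\<Prod>j\<in>{1..p}. e j (l j)) = of_bool (\<forall>j\<in>U. l j = 1)" for l
  proof (cases "\<forall>j\<in>U. l j = 1")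
    case False
    then obtain j where "j \<in> U" "l j \<noteq> 1" by blast
    then have "\<exists>j\<in>{1..p}. e j (l j) = 0" using U unfolding e_def by auto
    then have "(\<Prod>j\<in>{1..p}. e j (l j)) = 0" by (simp add: prod_zero_iff)
    then show ?thesis by (simp only: False of_bool_eq)
  qed (simp add: e_def)
  have "(\<Prod>j\<in>U. P i j 1) = (\<Sum>l\<in>{1..p} \<rightarrow>\<^sub>E {1, 2}. of_bool (\<forall>j\<in>U. l j = 1) * (\<Prod>j\<in>{1..p}. P i j (l j)))"
    if i: "i \<in> {1..r}" for i
  proof -
    have "(\<Sum>x\<in>{1, 2}. e j x * P i j x) = (if j \<in> U then P i j 1 else 1)" if "j \<in> {1..p}" for j
      using \<theta> i that by (auto simp: param_space_def e_def)
    then have "(\<Prod>j\<in>{1..p}. \<Sum>x\<in>{1, 2}. e j x * P i j x) = (\<Prod>j\<in>{1..p}. if j \<in> U then P i j 1 else 1)"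
      by (intro prod.cong refl) blast
    also have "\<dots> = (\<Prod>j\<in>U. P i j 1)"
      using U by (simp add: prod.inter_restrict[symmetric] Int_absorb1)
    finally have "(\<Prod>j\<in>U. P i j 1) = (\<Prod>j\<in>{1..p}. \<Sum>x\<in>{1, 2}. e j x * P i j x)" ..
    also have "\<dots> = (\<Sum>l\<in>{1..p} \<rightarrow>\<^sub>E {1, 2}. \<Prod>j\<in>{1..p}. e j (l j) * P i j (l j))"
      by (rule prod_sum_PiE) simp_all
    finally show ?thesis by (simp only: prod.distrib e)
  qed
  then have "(\<Sum>i\<in>{1..r}. w i * (\<Prod>j\<in>U. P i j 1))
     = (\<Sum>i\<in>{1..r}. \<Sum>l\<in>{1..p} \<rightarrow>\<^sub>E {1, 2}. of_bool (\<forall>j\<in>U. l j = 1) * (w i * (\<Prod>j\<in>{1..p}. P i j (l j))))"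
    by (simp add: sum_distrib_left mult_ac)
  also have "\<dots> = (\<Sum>l\<in>{1..p} \<rightarrow>\<^sub>E {1, 2}. of_bool (\<forall>j\<in>U. l j = 1) * joint_dist r p (w, P) l)"
    by (subst sum.swap) (auto simp: joint_dist_def sum_distrib_left intro!: sum.cong)
  finally show ?thesis .
qed

section \<open>Polynomial functions\<close>

text \<open>The functions that are polynomial in the coordinates \<open>I\<close> contain constants and coordinates and
  are closed under ring operations, hence under determinants.  With this closure the
  polynomial cutting out the exceptional variety need not be written out in monomials.\<close>

definition polynomial_function :: "'v set \<Rightarrow> (('v \<Rightarrow> real) \<Rightarrow> real) \<Rightarrow> bool" where
  "polynomial_function I g \<longleftrightarrow> (\<exists>f. indets f \<subseteq> I \<and> (\<forall>x. eval_mpoly x f = g x))"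

definition eval_monomial :: "('v \<Rightarrow> real) \<Rightarrow> ('v \<Rightarrow>\<^sub>0 nat) \<Rightarrow> real" where
  "eval_monomial x m = (\<Prod>v\<in>Poly_Mapping.keys m. x v ^ Poly_Mapping.lookup m v)"

lemma eval_monomial_superset:
  assumes "finite K" "Poly_Mapping.keys m \<subseteq> K"
  shows "eval_monomial x m = (\<Prod>v\<in>K. x v ^ Poly_Mapping.lookup m v)"
  unfolding eval_monomial_def
  using assms by (intro prod.mono_neutral_left) (auto simp: in_keys_iff)

lemma eval_monomial_add: "eval_monomial x (m + n) = eval_monomial x m * eval_monomial x n"
proof -
  let ?K = "Poly_Mapping.keys m \<union> Poly_Mapping.keys n"
  have "eval_monomial x k = (\<Prod>v\<in>?K. x v ^ Poly_Mapping.lookup k v)" if "k \<in> {m, n, m + n}" for k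
    using that keys_add[of m n] by (intro eval_monomial_superset) auto
  then show ?thesis by (simp add: lookup_add power_add prod.distrib)
qed

lemma eval_mpoly_superset:
  assumes "finite K" "Poly_Mapping.keys f \<subseteq> K"
  shows "eval_mpoly x f = (\<Sum>m\<in>K. Poly_Mapping.lookup f m * eval_monomial x m)"
  unfolding eval_mpoly_def eval_monomial_def[symmetric]
  using assms by (intro sum.mono_neutral_left) (auto simp: in_keys_iff)

lemma eval_mpoly_add: "eval_mpoly x (f + g) = eval_mpoly x f + eval_mpoly x g"
proof -
  let ?K = "Poly_Mapping.keys f \<union> Poly_Mapping.keys g"
  have "eval_mpoly x h = (\<Sum>m\<in>?K. Poly_Mapping.lookup h m * eval_monomial x m)" if "h \<in> {f, g, f + g}" for h
    using that keys_add[of f g] by (intro eval_mpoly_superset) auto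
  then show ?thesis by (simp add: lookup_add distrib_right sum.distrib)
qed

lemma eval_mpoly_zero [simp]: "eval_mpoly x 0 = 0"
  by (simp add: eval_mpoly_def)

lemma eval_mpoly_sum: "eval_mpoly x (sum f A) = (\<Sum>a\<in>A. eval_mpoly x (f a))"
  by (induction A rule: infinite_finite_induct) (auto simp: eval_mpoly_add)

lemma eval_mpoly_single [simp]: "eval_mpoly x (Poly_Mapping.single m c) = c * eval_monomial x m"
  by (subst eval_mpoly_superset[of "{m}"]) auto

lemma mpoly_eq_sum_single:
  fixes f :: "'v real_mpoly"
  shows "f = (\<Sum>m\<in>Poly_Mapping.keys f. Poly_Mapping.single m (Poly_Mapping.lookup f m))"
  by (rule poly_mapping_eqI)
     (auto simp: lookup_sum lookup_single when_def in_keys_iff)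

lemma eval_mpoly_mult: "eval_mpoly x (f * g) = eval_mpoly x f * eval_mpoly x g"
proof -
  let ?s = "\<lambda>h m. Poly_Mapping.single m (Poly_Mapping.lookup h m)"
  have "f * g = (\<Sum>m\<in>Poly_Mapping.keys f. \<Sum>n\<in>Poly_Mapping.keys g. ?s f m * ?s g n)"
    by (subst mpoly_eq_sum_single[of f], subst mpoly_eq_sum_single[of g]) (rule sum_product)
  then have "eval_mpoly x (f * g) = (\<Sum>m\<in>Poly_Mapping.keys f. \<Sum>n\<in>Poly_Mapping.keys g.
      (Poly_Mapping.lookup f m * eval_monomial x m) * (Poly_Mapping.lookup g n * eval_monomial x n))"
    by (simp add: eval_mpoly_sum mult_single eval_monomial_add mult_ac)
  then show ?thesis
    by (simp add: eval_mpoly_def[folded eval_monomial_def] sum_product)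
qed

lemma polynomial_function_const: "polynomial_function I (\<lambda>x. c)"
  unfolding polynomial_function_def
  by (intro exI[of _ "Poly_Mapping.single 0 c"]) (auto simp: indets_def eval_monomial_def)

lemma polynomial_function_var: "v \<in> I \<Longrightarrow> polynomial_function I (\<lambda>x. x v)"
  unfolding polynomial_function_def
  by (intro exI[of _ "Poly_Mapping.single (Poly_Mapping.single v 1) 1"])
     (auto simp: indets_def eval_monomial_def)

lemma polynomial_function_add:
  assumes "polynomial_function I g" "polynomial_function I h"
  shows "polynomial_function I (\<lambda>x. g x + h x)"
proof -
  obtain P Q where "indets P \<subseteq> I" "\<And>x. eval_mpoly x P = g x" "indets Q \<subseteq> I" "\<And>x. eval_mpoly x Q = h x"
    using assms unfolding polynomial_function_def by blast
  moreover have "indets (P + Q) \<subseteq> indets P \<union> indets Q"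
    unfolding indets_def using keys_add[of P Q] by blast
  ultimately show ?thesis
    unfolding polynomial_function_def
    by (intro exI[of _ "P + Q"]) (auto simp: eval_mpoly_add)
qed

lemma polynomial_function_mult:
  assumes "polynomial_function I g" "polynomial_function I h"
  shows "polynomial_function I (\<lambda>x. g x * h x)"
proof -
  obtain P Q where PQ: "indets P \<subseteq> I" "\<And>x. eval_mpoly x P = g x" "indets Q \<subseteq> I" "\<And>x. eval_mpoly x Q = h x"
    using assms unfolding polynomial_function_def by blast
  have "indets (P * Q) \<subseteq> I"
  proof
    fix v assume "v \<in> indets (P * Q)"
    then obtain k where k: "k \<in> Poly_Mapping.keys (P * Q)" "v \<in> Poly_Mapping.keys k"
      unfolding indets_def by blast
    then obtain m n where "k = m + n" "m \<in> Poly_Mapping.keys P" "n \<in> Poly_Mapping.keys Q"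
      using keys_mult[of P Q] by blast
    then show "v \<in> I"
      using k(2) keys_add[of m n] PQ(1,3) unfolding indets_def by blast
  qed
  then show ?thesis
    unfolding polynomial_function_def using PQ
    by (intro exI[of _ "P * Q"]) (auto simp: eval_mpoly_mult)
qed

lemma polynomial_function_sum:
  "(\<And>a. a \<in> A \<Longrightarrow> polynomial_function I (g a)) \<Longrightarrow> polynomial_function I (\<lambda>x. \<Sum>a\<in>A. g a x)"
  by (induction A rule: infinite_finite_induct)
     (auto intro: polynomial_function_const polynomial_function_add)

lemma polynomial_function_prod:
  "(\<And>a. a \<in> A \<Longrightarrow> polynomial_function I (g a)) \<Longrightarrow> polynomial_function I (\<lambda>x. \<Prod>a\<in>A. g a x)"
  by (induction A rule: infinite_finite_induct)
     (auto intro: polynomial_function_const polynomial_function_mult)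

lemma polynomial_function_diff:
  assumes "polynomial_function I g" "polynomial_function I h"
  shows "polynomial_function I (\<lambda>x. g x - h x)"
  using polynomial_function_add[OF assms(1) polynomial_function_mult[OF polynomial_function_const[of I "-1"] assms(2)]]
  by simp

lemma polynomial_function_det:
  assumes "\<And>i m. i < r \<Longrightarrow> m < r \<Longrightarrow> polynomial_function I (\<lambda>x. M x i m)"
  shows "polynomial_function I (\<lambda>x. det (mat r r (\<lambda>(i, m). M x i m)))"
proof -
  have "det (mat r r (\<lambda>(i, m). M x i m)) =
      (\<Sum>\<pi> | \<pi> permutes {0..<r}. signof \<pi> * (\<Prod>i = 0..<r. M x i (\<pi> i)))" for x
    by (subst det_def'[of _ r]) (auto simp: permutes_in_image intro!: sum.cong prod.cong arg_cong2[of _ _ _ _ "(*)"])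
  moreover have "polynomial_function I
      (\<lambda>x. \<Sum>\<pi> | \<pi> permutes {0..<r}. signof \<pi> * (\<Prod>i = 0..<r. M x i (\<pi> i)))"
    using assms permutes_in_image
    by (intro polynomial_function_sum polynomial_function_mult polynomial_function_const polynomial_function_prod)
       fastforce
  ultimately show ?thesis by simp
qed

text \<open>The zero polynomial evaluates to 0 everywhere, so one nonzero value makes the zero set proper.\<close>

lemma proper_subvariety_zero_set:
  assumes "polynomial_function I g" and "g z \<noteq> 0"
  shows "proper_subvariety I {x \<in> I \<rightarrow>\<^sub>E UNIV. g x = 0}"
proof -
  obtain f where f: "indets f \<subseteq> I" "\<And>x. eval_mpoly x f = g x"
    using assms(1) unfolding polynomial_function_def by blast
  then have "f \<noteq> 0" using assms(2) eval_mpoly_zero by metis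
  then show ?thesis unfolding proper_subvariety_def
    using f by (intro exI[of _ "{f}"]) auto
qed

section \<open>The non-degeneracy polynomial\<close>

text \<open>The block of features \<open>d + 1, \<dots>, d + k\<close> carries \<open>k\<close> binary digits, the digit of weight \<open>2\<^sup>t\<close>
  at feature \<open>d + t + 1\<close>; the set collects the features at which \<open>m\<close> has the digit 1.\<close>

definition binary_digit_block :: "nat \<Rightarrow> nat \<Rightarrow> nat \<Rightarrow> nat set" where
  "binary_digit_block d k m = (\<lambda>t. Suc (d + t)) ` {t. t < k \<and> bit m t}"

lemma binary_digit_block_subset: "binary_digit_block d k m \<subseteq> {d + 1..d + k}"
  by (auto simp: binary_digit_block_def)

lemma le_if_digits_subset:
  fixes m i :: nat
  assumes "m < 2 ^ k" and "\<And>t. t < k \<Longrightarrow> bit m t \<Longrightarrow> bit i t"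
  shows "m \<le> i"
proof -
  have "bit m t \<Longrightarrow> t < k" for t
    using assms(1) by (metis bit_nat_iff bit_take_bit_iff take_bit_nat_eq_self)
  then have "and i m = m"
    using assms(2) by (auto intro!: bit_eqI simp: bit_and_iff)
  moreover have "int (and i m) \<le> int i"
    unfolding of_nat_and_eq by simp
  ultimately show ?thesis by simp
qed

text \<open>If class \<open>i\<close> has the digits of \<open>i\<close> as feature values, then the entry \<open>(i, m)\<close> is 1 or 0
  according to whether the digits 1 of \<open>m\<close> are among those of \<open>i\<close>.  This forces \<open>m \<le> i\<close>, so the matrix is
  lower triangular, and the diagonal entries are 1.\<close>

lemma det_digit_matrix:
  fixes a :: "nat \<Rightarrow> nat \<Rightarrow> real"
  assumes "r \<le> 2 ^ k"
    and a: "\<And>i t. i < r \<Longrightarrow> t < k \<Longrightarrow> a i (Suc (d + t)) = of_bool (bit i t)"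
  shows "det (mat r r (\<lambda>(i, m). prod (a i) (binary_digit_block d k m))) = 1"
proof -
  have entry: "prod (a i) (binary_digit_block d k m) = of_bool (\<forall>t<k. bit m t \<longrightarrow> bit i t)"
    if "i < r" for i m
  proof -
    have "prod (a i) (binary_digit_block d k m) = (\<Prod>t\<in>{t. t < k \<and> bit m t}. of_bool (bit i t))"
      unfolding binary_digit_block_def
      by (subst prod.reindex) (auto simp: inj_on_def a that intro!: prod.cong)
    also have "\<dots> = of_bool (\<forall>t<k. bit m t \<longrightarrow> bit i t)"
      by (cases "\<forall>t<k. bit m t \<longrightarrow> bit i t") (auto simp: prod_zero_iff)
    finally show ?thesis .
  qed
  let ?A = "mat r r (\<lambda>(i, m). prod (a i) (binary_digit_block d k m))"
  have "det ?A = prod_list (diag_mat ?A)"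
  proof (rule det_lower_triangular)
    fix i m assume im: "i < m" "m < r"
    then have "\<not> (\<forall>t<k. bit m t \<longrightarrow> bit i t)"
      using le_if_digits_subset[of m k i] assms(1) by force
    then show "?A $$ (i, m) = 0" using im by (simp add: entry)
  qed simp
  also have "\<dots> = 1"
    unfolding prod_list_diag_prod by (intro prod.neutral) (simp add: entry)
  finally show ?thesis .
qed

text \<open>Classes are labelled from 1 and matrix rows from 0, whence the shift by one.\<close>

definition block_det :: "nat \<Rightarrow> nat \<Rightarrow> nat \<Rightarrow> (coord \<Rightarrow> real) \<Rightarrow> real" where
  "block_det r k d x =
     det (mat r r (\<lambda>(i, m). \<Prod>j\<in>binary_digit_block d k m. x (Prob (Suc i) j)))"

definition nondegeneracy :: "nat \<Rightarrow> nat \<Rightarrow> (coord \<Rightarrow> real) \<Rightarrow> real" where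
  "nondegeneracy r k x = block_det r k 0 x * block_det r k k x *
     (\<Prod>i\<in>{1..r}. \<Prod>h\<in>{1..r} - {i}. x (Prob i (2 * k + 1)) - x (Prob h (2 * k + 1)))"

lemma polynomial_function_nondegeneracy:
  assumes "2 * k + 1 \<le> p"
  shows "polynomial_function (coords r p) (nondegeneracy r k)"
proof -
  have var: "polynomial_function (coords r p) (\<lambda>x. x (Prob i j))" if "i \<in> {1..r}" "j \<in> {1..p}" for i j
    using that by (intro polynomial_function_var) (auto simp: coords_def)
  have block: "polynomial_function (coords r p) (block_det r k d)" if "d + k \<le> p" for d
    unfolding block_det_def
  proof (intro polynomial_function_det polynomial_function_prod var)
    fix i m j assume "i < r" "j \<in> binary_digit_block d k m"
    then show "Suc i \<in> {1..r}" "j \<in> {1..p}"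
      using binary_digit_block_subset[of d k m] that by auto
  qed
  show ?thesis
    unfolding nondegeneracy_def using assms
    by (intro polynomial_function_mult polynomial_function_prod polynomial_function_diff var block) auto
qed

text \<open>The point \<open>z\<close> gives both blocks the binary digits of the class number (from 0) and
  feature \<open>2 * k + 1\<close> the class label itself.  It need not be a probability: a polynomial that is nonzero
  at any real point is a nonzero polynomial.\<close>

lemma nondegeneracy_nonzero_somewhere:
  assumes "r \<le> 2 ^ k"
  shows "\<exists>z. nondegeneracy r k z \<noteq> 0"
proof -
  define z :: "coord \<Rightarrow> real" where
    "z v = (case v of Weight i \<Rightarrow> 0 | Prob i j \<Rightarrow>
       if j \<le> k then of_bool (bit (i - 1) (j - 1))
       else if j \<le> 2 * k then of_bool (bit (i - 1) (j - 1 - k)) else real i)" for v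
  have "block_det r k 0 z = 1" "block_det r k k z = 1"
    unfolding block_det_def
    by (rule det_digit_matrix[OF assms, of "\<lambda>i j. z (Prob (Suc i) j)"]; simp add: z_def)+
  then have "nondegeneracy r k z \<noteq> 0"
    by (auto simp: nondegeneracy_def prod_zero_iff z_def)
  then show ?thesis by blast
qed

lemma dual_family_if_block_det_nonzero:
  assumes "block_det r k d x \<noteq> 0" and "\<And>i j. i \<in> {1..r} \<Longrightarrow> j \<in> {d+1..d+k} \<Longrightarrow> x (Prob i j) = a i j"
  obtains f where "\<And>h i. h \<in> {1..r} \<Longrightarrow> i \<in> {1..r} \<Longrightarrow>
    (\<Sum>m<r. f m i * prod (a h) (binary_digit_block d k m)) = of_bool (h = i)"
proof -
  have "mat r r (\<lambda>(i, m). \<Prod>j\<in>binary_digit_block d k m. x (Prob (Suc i) j))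
      = mat r r (\<lambda>(i, m). prod (a (Suc i)) (binary_digit_block d k m))"
  proof (intro cong_mat refl, unfold prod.case, intro prod.cong refl)
    fix i m j assume "i < r" "j \<in> binary_digit_block d k m"
    then show "x (Prob (Suc i) j) = a (Suc i) j"
      using binary_digit_block_subset[of d k m] by (intro assms(2)) auto
  qed
  then have "det (mat r r (\<lambda>(i, m). prod (a (Suc i)) (binary_digit_block d k m))) \<noteq> 0"
    using assms(1) by (simp add: block_det_def)
  from dual_family_if_det_nonzero[OF this, of thesis] that show thesis by blast
qed

section \<open>Generic identifiability\<close>

lemma identifiable_if_nondegenerate:
  assumes p: "2 * k + 1 \<le> p"
    and \<theta>: "(w, P) \<in> param_space r p" and \<theta>': "(w', P') \<in> param_space r p"
    and nz: "nondegeneracy r k (coord_vector r p (w, P)) \<noteq> 0"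
    and eq: "joint_dist r p (w', P') = joint_dist r p (w, P)"
  shows "label_swap_eq r p (w, P) (w', P')"
proof -
  let ?a = "\<lambda>i j. P i j 1" and ?a' = "\<lambda>i j. P' i j 1"
  let ?x = "coord_vector r p (w, P)" and ?c = "2 * k + 1"
  have x: "?x (Prob i j) = ?a i j" if "i \<in> {1..r}" "j \<in> {1..p}" for i j
    using that by (auto simp: coord_vector_def coords_def)
  have "block_det r k 0 ?x \<noteq> 0" "block_det r k k ?x \<noteq> 0"
    using nz by (auto simp: nondegeneracy_def)
  obtain f where f: "\<And>h i. h \<in> {1..r} \<Longrightarrow> i \<in> {1..r} \<Longrightarrow>
      (\<Sum>m<r. f m i * prod (?a h) (binary_digit_block 0 k m)) = of_bool (h = i)"
    by (rule dual_family_if_block_det_nonzero[OF \<open>block_det r k 0 ?x \<noteq> 0\<close>, of ?a]) (use x p in auto)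
  obtain g where g: "\<And>h i. h \<in> {1..r} \<Longrightarrow> i \<in> {1..r} \<Longrightarrow>
      (\<Sum>m<r. g m i * prod (?a h) (binary_digit_block k k m)) = of_bool (h = i)"
    by (rule dual_family_if_block_det_nonzero[OF \<open>block_det r k k ?x \<noteq> 0\<close>, of ?a]) (use x p in auto)
  have inj: "inj_on (\<lambda>i. ?a i ?c) {1..r}"
  proof (rule inj_onI, rule ccontr)
    fix i h assume "i \<in> {1..r}" "h \<in> {1..r}" "?a i ?c = ?a h ?c" "i \<noteq> h"
    then have "\<exists>i\<in>{1..r}. \<exists>h\<in>{1..r} - {i}. ?x (Prob i ?c) - ?x (Prob h ?c) = 0"
      using p by (intro bexI[of _ i] bexI[of _ h]) (auto simp: x)
    then show False using nz by (auto simp: nondegeneracy_def prod_zero_iff)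
  qed
  have mom: "(\<Sum>i\<in>{1..r}. w i * prod (?a i) U) = (\<Sum>i\<in>{1..r}. w' i * prod (?a' i) U)"
    if "U \<subseteq> {1..p}" for U
    using moments_from_joint_dist[OF \<theta> that] moments_from_joint_dist[OF \<theta>' that] eq by simp
  have "\<exists>\<sigma>. \<sigma> permutes {1..r} \<and>
      (\<forall>i\<in>{1..r}. w' i = w (\<sigma> i) \<and> (\<forall>j\<in>{1..p}. ?a' i j = ?a (\<sigma> i) j))"
  proof (rule mixture_determined_by_moments[where a = ?a and a' = ?a' and c = ?c
        and A = "{1..k}" and B = "{k+1..2*k}"
        and S = "binary_digit_block 0 k" and T = "binary_digit_block k k" and f = f and g = g])
    show "w i \<noteq> 0" if "i \<in> {1..r}" for i
    proof -
      have "0 < w i" using \<theta> that unfolding param_space_def by blast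
      then show ?thesis by simp
    qed
    show "finite {1..p}" "{1..k} \<subseteq> {1..p}" "{k+1..2*k} \<subseteq> {1..p}" "?c \<in> {1..p}"
      "{1..k} \<inter> {k+1..2*k} = {}" "?c \<notin> {1..k}" "?c \<notin> {k+1..2*k}"
      using p by auto
    show "binary_digit_block 0 k m \<subseteq> {1..k}" "binary_digit_block k k m \<subseteq> {k+1..2*k}" for m
      using binary_digit_block_subset[of 0 k m] binary_digit_block_subset[of k k m] by auto
  qed (rule mom f g inj; assumption)+
  then obtain \<sigma> where \<sigma>: "\<sigma> permutes {1..r}"
    and match: "\<And>i. i \<in> {1..r} \<Longrightarrow> w' i = w (\<sigma> i)"
      "\<And>i j. i \<in> {1..r} \<Longrightarrow> j \<in> {1..p} \<Longrightarrow> P' i j 1 = P (\<sigma> i) j 1"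
    by blast
  have "P' i j 2 = P (\<sigma> i) j 2" if ij: "i \<in> {1..r}" "j \<in> {1..p}" for i j
  proof -
    have "\<sigma> i \<in> {1..r}" using \<sigma> ij by (simp only: permutes_in_image)
    then have "P' i j 1 + P' i j 2 = 1" "P (\<sigma> i) j 1 + P (\<sigma> i) j 2 = 1"
      using \<theta> \<theta>' ij unfolding param_space_def by blast+
    then show ?thesis using match(2)[OF ij] by simp
  qed
  then show ?thesis
    unfolding label_swap_eq_def split_conv using \<sigma> match by blast
qed

theorem corollary5:
  fixes r p :: nat
  assumes "0 < r" and "0 < p"
    and "int p \<ge> 2 * \<lceil>log 2 (real r)\<rceil> + 1"
  shows "generically_identifiable r p"
proof -
  define k where "k = nat \<lceil>log 2 (real r)\<rceil>"
  have k: "int k = \<lceil>log 2 (real r)\<rceil>"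
  proof -
    have "0 \<le> log 2 (real r)" using assms(1) by simp
    then have "0 \<le> \<lceil>log 2 (real r)\<rceil>" by linarith
    then show ?thesis by (simp add: k_def)
  qed
  then have p: "2 * k + 1 \<le> p" using assms(3) by linarith
  have "log 2 (real r) \<le> real k" using k by linarith
  then have "real r \<le> 2 powr real k"
    using assms(1) by (simp add: log_le_iff)
  then have "r \<le> 2 ^ k"
    by (simp add: powr_realpow)
  then obtain z where z: "nondegeneracy r k z \<noteq> 0"
    using nondegeneracy_nonzero_somewhere by blast
  let ?V = "{x \<in> coords r p \<rightarrow>\<^sub>E UNIV. nondegeneracy r k x = 0}"
  have "proper_subvariety (coords r p) ?V"
    using polynomial_function_nondegeneracy[OF p] z by (rule proper_subvariety_zero_set)
  moreover have "label_swap_eq r p \<theta> \<theta>'"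
    if "\<theta> \<in> param_space r p" "coord_vector r p \<theta> \<notin> ?V" "\<theta>' \<in> param_space r p"
      "joint_dist r p \<theta>' = joint_dist r p \<theta>" for \<theta> \<theta>'
  proof -
    have "coord_vector r p \<theta> \<in> coords r p \<rightarrow>\<^sub>E UNIV"
      by (cases \<theta>) (simp add: coord_vector_def)
    then show ?thesis
      using that identifiable_if_nondegenerate[OF p, of "fst \<theta>" "snd \<theta>" r "fst \<theta>'" "snd \<theta>'"] by simp
  qed
  ultimately show ?thesis
    unfolding generically_identifiable_def by blast
qed

end
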